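(* Let $a_1,a_2$ be positive integers and let $r_i$ ($0\le i\le a_2$) be any vertex on the oriented cycle in $Q=Q[a_1,a_2]$. Then the $A$-module $M(r_i)$ has exactly $a_1a_2+1$ submodules.
   Context: Let $k$ be an algebraically closed field. $Q=Q[a_1,a_2]$ has vertices $r_0,\dots,r_{a_2}$, $s_1,\dots,s_{a_1-1}$, $t_1,\dots,t_{a_1-1}$ (no $s$- or $t$-vertices if $a_1=1$) and arrows forming the oriented cycle $r_0\to r_1\to\cdots\to r_{a_2}\to r_0$, the branch $s_1\to s_2\to\cdots\to s_{a_1-1}\to r_{a_2}$ and the branch $r_0\to t_1\to\cdots\to t_{a_1-1}$. $A=kQ/I$, where $I$ is the two-sided ideal generated by all subpaths of length $a_2$ of the oriented cycle; $A$-modules are finite-dimensional representations of $Q$ satisfying these relations. $M(r_i)$ is the representation with the space $k$ at every vertex of its support and $0$ elsewhere, identity maps on arrows between two vertices of the support, and zero maps on the other arrows, where the support is $Q_0\setminus\{r_i\}$ for $1\le i\le a_2-1$, $Q_0\setminus\{r_0,t_1,\dots,t_{a_1-1}\}$ for $i=0$, and $Q_0\setminus\{r_{a_2},s_1,\dots,s_{a_1-1}\}$ for $i=a_2$. The zero module and $M(r_i)$ itself are counted as submodules. *)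

theory Defs
  imports
    "HOL-Computational_Algebra.Polynomial"
    "HOL-Library.FuncSet"
    "Graph_Theory.Arc_Walk"
begin

section \<open>Representations of quivers\<close>

text \<open>
  A quiver is a multi-digraph.  A representation assigns to every vertex a finite-dimensional
  subspace of an ambient vector space with scalar multiplication \<open>scale\<close>, and to every arrow
  a linear map between these subspaces.  The values at non-vertices and non-arrows, and the values
  of a map outside its source space, are irrelevant.
\<close>

record ('v, 'e, 'b) quiver_rep =
  rep_space :: "'v \<Rightarrow> 'b set"
  rep_map :: "'e \<Rightarrow> 'b \<Rightarrow> 'b"

definition linear_between ::
  "('k::field \<Rightarrow> 'b::ab_group_add \<Rightarrow> 'b) \<Rightarrow> 'b set \<Rightarrow> 'b set \<Rightarrow> ('b \<Rightarrow> 'b) \<Rightarrow> bool"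
  where
  "linear_between scale V W f \<longleftrightarrow>
     f \<in> V \<rightarrow> W \<and>
     (\<forall>x\<in>V. \<forall>y\<in>V. f (x + y) = f x + f y) \<and>
     (\<forall>c. \<forall>x\<in>V. f (scale c x) = scale c (f x))"

definition representation ::
  "('k::field \<Rightarrow> 'b::ab_group_add \<Rightarrow> 'b) \<Rightarrow> ('v, 'e) pre_digraph \<Rightarrow> ('v, 'e, 'b) quiver_rep \<Rightarrow> bool"
  where
  "representation scale Q M \<longleftrightarrow>
     vector_space scale \<and>
     (\<forall>v\<in>verts Q. module.subspace scale (rep_space M v) \<and>
        (\<exists>B. finite B \<and> module.span scale B = rep_space M v)) \<and>
     (\<forall>e\<in>arcs Q. linear_between scale
        (rep_space M (tail Q e)) (rep_space M (head Q e)) (rep_map M e))"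

text \<open>
  A path is the list of its arrows in the order in which they are traversed, so the first arrow of
  the list acts first.
\<close>

definition rep_path :: "('v, 'e, 'b) quiver_rep \<Rightarrow> 'e list \<Rightarrow> 'b \<Rightarrow> 'b" where
  "rep_path M p = fold (rep_map M) p"

definition satisfies_relations ::
  "('v, 'e) pre_digraph \<Rightarrow> 'e list set \<Rightarrow> ('v, 'e, 'b::zero) quiver_rep \<Rightarrow> bool"
  where
  "satisfies_relations Q P M \<longleftrightarrow>
     (\<forall>p\<in>P. \<forall>u v. pre_digraph.awalk Q u p v \<longrightarrow> (\<forall>x\<in>rep_space M u. rep_path M p x = 0))"

text \<open>
  The submodules of \<open>M\<close> are its subrepresentations; they inherit all relations from \<open>M\<close>.
  The families are extensional (\<open>undefined\<close> at non-vertices), so that each subrepresentation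
  is counted once.
\<close>

definition submodules ::
  "('k::field \<Rightarrow> 'b::ab_group_add \<Rightarrow> 'b) \<Rightarrow> ('v, 'e) pre_digraph \<Rightarrow> ('v, 'e, 'b) quiver_rep
     \<Rightarrow> ('v \<Rightarrow> 'b set) set"
  where
  "submodules scale Q M =
     {U \<in> (\<Pi>\<^sub>E v\<in>verts Q. {W. module.subspace scale W \<and> W \<subseteq> rep_space M v}).
        \<forall>e\<in>arcs Q. rep_map M e ` U (tail Q e) \<subseteq> U (head Q e)}"


section \<open>The quiver \<open>Q[a\<^sub>1, a\<^sub>2]\<close> and the algebra \<open>A\<close>\<close>

datatype vertex = Rv nat | Sv nat | Tv nat

text \<open>Since the quiver has no parallel arrows, an arrow is given by its source and target.\<close>

type_synonym arrow = "vertex \<times> vertex"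

definition S_verts :: "nat \<Rightarrow> vertex set" where
  "S_verts a1 = Sv ` {1..<a1}"

definition T_verts :: "nat \<Rightarrow> vertex set" where
  "T_verts a1 = Tv ` {1..<a1}"

definition Q_verts :: "nat \<Rightarrow> nat \<Rightarrow> vertex set" where
  "Q_verts a1 a2 = Rv ` {0..a2} \<union> S_verts a1 \<union> T_verts a1"

definition cycle_arrows :: "nat \<Rightarrow> arrow set" where
  "cycle_arrows a2 = {(Rv i, Rv (i + 1)) | i. i < a2} \<union> {(Rv a2, Rv 0)}"

definition S_arrows :: "nat \<Rightarrow> nat \<Rightarrow> arrow set" where
  "S_arrows a1 a2 = {(Sv i, Sv (i + 1)) | i. 1 \<le> i \<and> i + 1 < a1} \<union>
     (if 1 < a1 then {(Sv (a1 - 1), Rv a2)} else {})"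

definition T_arrows :: "nat \<Rightarrow> arrow set" where
  "T_arrows a1 = (if 1 < a1 then {(Rv 0, Tv 1)} else {}) \<union>
     {(Tv i, Tv (i + 1)) | i. 1 \<le> i \<and> i + 1 < a1}"

definition quiverQ :: "nat \<Rightarrow> nat \<Rightarrow> (vertex, arrow) pre_digraph" where
  "quiverQ a1 a2 = \<lparr>verts = Q_verts a1 a2,
     arcs = cycle_arrows a2 \<union> S_arrows a1 a2 \<union> T_arrows a1,
     tail = fst, head = snd\<rparr>"

lemma fin_digraph_quiverQ: "fin_digraph (quiverQ a1 a2)"
proof
  have "cycle_arrows a2 \<union> S_arrows a1 a2 \<union> T_arrows a1 \<subseteq> Q_verts a1 a2 \<times> Q_verts a1 a2"
    by (auto simp: Q_verts_def S_verts_def T_verts_def cycle_arrows_def S_arrows_def T_arrows_def)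
  moreover have "finite (Q_verts a1 a2)"
    by (simp add: Q_verts_def S_verts_def T_verts_def)
  ultimately show "\<And>e. e \<in> arcs (quiverQ a1 a2) \<Longrightarrow> tail (quiverQ a1 a2) e \<in> verts (quiverQ a1 a2)"
    "\<And>e. e \<in> arcs (quiverQ a1 a2) \<Longrightarrow> head (quiverQ a1 a2) e \<in> verts (quiverQ a1 a2)"
    "finite (verts (quiverQ a1 a2))" "finite (arcs (quiverQ a1 a2))"
    unfolding quiverQ_def by (auto intro: finite_subset[OF _ finite_cartesian_product])
qed

text \<open>The paths generating the ideal \<open>I\<close>.\<close>

definition relations :: "nat \<Rightarrow> nat \<Rightarrow> arrow list set" where
  "relations a1 a2 =
     {p. (\<exists>u v. pre_digraph.awalk (quiverQ a1 a2) u p v) \<and> set p \<subseteq> cycle_arrows a2 \<and> length p = a2}"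

text \<open>
  Modules over \<open>A = kQ/I\<close> are the representations of \<open>Q\<close> satisfying the relations
  that generate \<open>I\<close>.
\<close>

definition A_module ::
  "('k::field \<Rightarrow> 'b::ab_group_add \<Rightarrow> 'b) \<Rightarrow> nat \<Rightarrow> nat \<Rightarrow> (vertex, arrow, 'b) quiver_rep \<Rightarrow> bool"
  where
  "A_module scale a1 a2 M \<longleftrightarrow>
     representation scale (quiverQ a1 a2) M \<and> satisfies_relations (quiverQ a1 a2) (relations a1 a2) M"

definition M_support :: "nat \<Rightarrow> nat \<Rightarrow> nat \<Rightarrow> vertex set" where
  "M_support a1 a2 i =
     (if i = 0 then Q_verts a1 a2 - ({Rv 0} \<union> T_verts a1)
      else if i = a2 then Q_verts a1 a2 - ({Rv a2} \<union> S_verts a1)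
      else Q_verts a1 a2 - {Rv i})"

definition modM :: "nat \<Rightarrow> nat \<Rightarrow> nat \<Rightarrow> (vertex, arrow, 'k::field) quiver_rep" where
  "modM a1 a2 i =
     \<lparr>rep_space = (\<lambda>v. if v \<in> M_support a1 a2 i then UNIV else {0}),
      rep_map = (\<lambda>(u, v). if u \<in> M_support a1 a2 i \<and> v \<in> M_support a1 a2 i
                          then (\<lambda>x. x) else (\<lambda>x. 0))\<rparr>"

end

theory Submission
  imports Defs
begin

text \<open>
  Every space of \<open>M(r\<^sub>i)\<close> is \<open>0\<close> or the ground field, which has no proper nonzero subspace.  So a
  submodule is determined by its set of vertices with nonzero space, and the sets that occur are the
  subsets \<open>X\<close> of the support that are closed under following arrows inside the support.

  Removing \<open>r\<^sub>i\<close> opens the cycle into the linear path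
  \<open>r\<^bsub>i+1\<^esub> \<rightarrow> \<dots> \<rightarrow> r\<^bsub>a\<^sub>2\<^esub> \<rightarrow> r\<^sub>0 \<rightarrow> \<dots> \<rightarrow> r\<^bsub>i-1\<^esub>\<close>, with the \<open>s\<close>-branch running into \<open>r\<^bsub>a\<^sub>2\<^esub>\<close> and the \<open>t\<close>-branch
  leaving \<open>r\<^sub>0\<close>.  Call middle set the smallest closed set containing \<open>r\<^sub>0\<close>, and let it be empty for
  \<open>i = 0\<close>, when \<open>r\<^sub>0\<close> is not in the support.  Every closed set is comparable with it.
  For \<open>i > 0\<close>, a closed set that contains neither \<open>r\<^sub>0\<close> nor \<open>r\<^bsub>a\<^sub>2\<^esub>\<close> consists of a final segment of each
  of the two chains \<open>r\<^sub>1, \<dots>, r\<^bsub>i-1\<^esub>\<close> and \<open>t\<^sub>1, \<dots>, t\<^bsub>a\<^sub>1-1\<^esub>\<close>, which gives \<open>i a\<^sub>1\<close> sets properly inside the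
  middle one.  A closed set that contains \<open>r\<^sub>0\<close> but not \<open>r\<^bsub>a\<^sub>2\<^esub>\<close> is the middle set.  A closed set that contains \<open>r\<^bsub>a\<^sub>2\<^esub>\<close> is the middle set together with \<open>r\<^bsub>a\<^sub>2\<^esub>\<close> and final
  segments of \<open>r\<^bsub>i+1\<^esub>, \<dots>, r\<^bsub>a\<^sub>2-1\<^esub>\<close> and \<open>s\<^sub>1, \<dots>, s\<^bsub>a\<^sub>1-1\<^esub>\<close>, which gives \<open>(a\<^sub>2 - i) a\<^sub>1\<close> sets properly above it.
  The total is \<open>i a\<^sub>1 + 1 + (a\<^sub>2 - i) a\<^sub>1 = a\<^sub>1 a\<^sub>2 + 1\<close> for every \<open>i\<close>, the extreme cases \<open>i = 0\<close> and
  \<open>i = a\<^sub>2\<close> included.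

  The relations hold because the opened cycle has only \<open>a\<^sub>2\<close> vertices, so that a path of length \<open>a\<^sub>2\<close>
  on the cycle has to pass through \<open>r\<^sub>i\<close>, where \<open>M(r\<^sub>i)\<close> vanishes.
\<close>


section \<open>Submodules of thin representations\<close>

lemma vector_space_times: "vector_space ((*) :: 'k::field \<Rightarrow> 'k \<Rightarrow> 'k)"
  by unfold_locales (auto simp: algebra_simps)

lemma subspace_field_iff:
  fixes W :: "'k::field set"
  shows "module.subspace (*) W \<longleftrightarrow> W = {0} \<or> W = UNIV"
proof -
  interpret vector_space "(*) :: 'k \<Rightarrow> 'k \<Rightarrow> 'k" by (rule vector_space_times)
  have "W = UNIV" if W: "subspace W" and "W \<noteq> {0}"
  proof -
    obtain x where x: "x \<in> W" "x \<noteq> 0"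
      using \<open>W \<noteq> {0}\<close> subspace_0[OF W] by blast
    have "y \<in> W" for y
      using subspace_scale[OF W x(1), of "y / x"] x(2) by simp
    then show ?thesis by blast
  qed
  then show ?thesis by (auto simp: subspace_def)
qed

definition closed_subsets :: "('v, 'e) pre_digraph \<Rightarrow> 'v set \<Rightarrow> 'v set set" where
  "closed_subsets G S =
     {X. X \<subseteq> S \<and> (\<forall>e\<in>arcs G. tail G e \<in> X \<longrightarrow> head G e \<in> S \<longrightarrow> head G e \<in> X)}"

text \<open>
  The only choice at a vertex of the support is between \<open>0\<close> and the whole field, and an identity
  arrow forces its target to be chosen whenever its source is.
\<close>

lemma card_submodules_thin:
  fixes M :: "('v, 'e, 'k::field) quiver_rep"
  assumes "wf_digraph G" and S: "S \<subseteq> verts G"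
    and space: "\<And>v. rep_space M v = (if v \<in> S then UNIV else {0})"
    and map: "\<And>e x. rep_map M e x = (if tail G e \<in> S \<and> head G e \<in> S then x else 0)"
  shows "card (submodules (*) G M) = card (closed_subsets G S)"
proof -
  interpret wf_digraph G by fact
  define F :: "'v set \<Rightarrow> 'v \<Rightarrow> 'k set" where
    "F X = (\<lambda>v\<in>verts G. if v \<in> X then UNIV else {0})" for X
  have UNIV_ne: "(UNIV :: 'k set) \<noteq> {0}"
    by (metis UNIV_I singletonD zero_neq_one)
  have "bij_betw F (closed_subsets G S) (submodules (*) G M)"
  proof (rule bij_betw_imageI)
    show "inj_on F (closed_subsets G S)"
    proof (rule inj_onI)
      fix X Y assume XY: "X \<in> closed_subsets G S" "Y \<in> closed_subsets G S" and eq: "F X = F Y"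
      have "v \<in> X \<longleftrightarrow> v \<in> Y" if "v \<in> verts G" for v
        using fun_cong[OF eq, of v] that UNIV_ne by (auto simp: F_def split: if_splits)
      with XY S show "X = Y" by (auto simp: closed_subsets_def)
    qed
    show "F ` closed_subsets G S = submodules (*) G M"
    proof (intro equalityI subsetI)
      fix U assume "U \<in> F ` closed_subsets G S"
      then obtain X where X: "X \<in> closed_subsets G S" and U: "U = F X" by blast
      have X_simps: "X \<subseteq> S" "\<And>e. e \<in> arcs G \<Longrightarrow> tail G e \<in> X \<Longrightarrow> head G e \<in> S \<Longrightarrow> head G e \<in> X"
        using X by (simp_all add: closed_subsets_def)
      have "U \<in> (\<Pi>\<^sub>E v\<in>verts G. {W. module.subspace (*) W \<and> W \<subseteq> rep_space M v})"
        unfolding U F_def using X_simps(1)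
        by (intro restrict_PiE_iff[THEN iffD2]) (simp add: subspace_field_iff space subset_iff)
      moreover have "rep_map M e x \<in> U (head G e)" if "e \<in> arcs G" "x \<in> U (tail G e)" for e x
        using that X_simps(2)[OF that(1)] X_simps(1)
        by (cases "tail G e \<in> X") (simp_all add: U F_def map)
      ultimately show "U \<in> submodules (*) G M"
        unfolding submodules_def by blast
    next
      fix U assume U: "U \<in> submodules (*) G M"
      have dichotomy: "U v = {0} \<or> U v = UNIV" "U v \<subseteq> rep_space M v" if "v \<in> verts G" for v
        using U that by (auto simp: submodules_def subspace_field_iff dest!: PiE_mem)
      have arrow: "rep_map M e x \<in> U (head G e)" if "e \<in> arcs G" "x \<in> U (tail G e)" for e x
        using U that unfolding submodules_def by blast
      define X where "X = {v \<in> verts G. U v = UNIV}"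
      have XS: "X \<subseteq> S"
      proof
        fix v assume "v \<in> X"
        then have "(1 :: 'k) \<in> U v" and "U v \<subseteq> rep_space M v"
          using dichotomy(2)[of v] by (simp_all add: X_def)
        then have "1 \<in> rep_space M v" by (rule rev_subsetD)
        then show "v \<in> S" by (simp add: space split: if_splits)
      qed
      have "head G e \<in> X" if e: "e \<in> arcs G" "tail G e \<in> X" "head G e \<in> S" for e
      proof -
        have "tail G e \<in> S" using e(2) XS by blast
        then have "1 \<in> U (head G e)"
          using arrow[of e 1] e by (simp add: X_def map)
        with dichotomy(1)[OF head_in_verts[OF e(1)]] have "U (head G e) = UNIV"
          by (metis singletonD zero_neq_one)
        then show ?thesis by (simp add: X_def e(1))
      qed
      with XS have "X \<in> closed_subsets G S" by (auto simp: closed_subsets_def)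
      moreover have "U = F X"
      proof (rule ext)
        show "U v = F X v" for v
        proof (cases "v \<in> verts G")
          case True
          have "U v = (if U v = UNIV then UNIV else {0})"
            using dichotomy(1)[OF True] by metis
          also have "\<dots> = F X v"
            using True by (simp add: F_def X_def)
          finally show ?thesis .
        next
          case False
          moreover have "U v = undefined"
            using U False unfolding submodules_def by (blast dest: PiE_arb)
          ultimately show ?thesis by (simp add: F_def)
        qed
      qed
      ultimately show "U \<in> F ` closed_subsets G S" by blast
    qed
  qed
  then show ?thesis by (simp add: bij_betw_same_card)
qed


section \<open>The relations\<close>

lemma support_simps:
  assumes "0 < a2" "i \<le> a2"
  shows "Rv k \<in> M_support a1 a2 i \<longleftrightarrow> k \<le> a2 \<and> k \<noteq> i"
    and "Sv k \<in> M_support a1 a2 i \<longleftrightarrow> 1 \<le> k \<and> k < a1 \<and> i \<noteq> a2"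
    and "Tv k \<in> M_support a1 a2 i \<longleftrightarrow> 1 \<le> k \<and> k < a1 \<and> i \<noteq> 0"
  using assms by (auto simp: M_support_def Q_verts_def S_verts_def T_verts_def)

lemma modM_simps:
  "rep_space (modM a1 a2 i) v = (if v \<in> M_support a1 a2 i then UNIV else {0})"
  "rep_map (modM a1 a2 i) e x =
     (if fst e \<in> M_support a1 a2 i \<and> snd e \<in> M_support a1 a2 i then x else 0)"
  by (auto simp: modM_def split: prod.split)

lemma fold_rep_map_0: "fold (rep_map (modM a1 a2 i)) p 0 = 0"
  by (induction p) (auto simp: modM_simps)

lemma rep_path_modM_eq_0:
  assumes "e \<in> set p" and "fst e \<notin> M_support a1 a2 i \<or> snd e \<notin> M_support a1 a2 i"
  shows "rep_path (modM a1 a2 i) p x = 0"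
  using assms(1) unfolding rep_path_def
proof (induction p arbitrary: x)
  case (Cons d p)
  show ?case
  proof (cases "d = e")
    case True
    then have "rep_map (modM a1 a2 i) d x = 0" using assms(2) by (auto simp: modM_simps)
    then show ?thesis by (simp add: fold_rep_map_0)
  next
    case False
    with Cons show ?thesis by simp
  qed
qed simp

text \<open>The position of \<open>r\<^sub>j\<close> on the path from \<open>r\<^bsub>i+1\<^esub>\<close> to \<open>r\<^bsub>i-1\<^esub>\<close> that remains of the cycle without \<open>r\<^sub>i\<close>.\<close>

definition cycle_rank :: "nat \<Rightarrow> nat \<Rightarrow> vertex \<Rightarrow> nat" where
  "cycle_rank a2 i v = (case v of Rv j \<Rightarrow> if i < j then j - i - 1 else j + a2 - i | _ \<Rightarrow> 0)"

text \<open>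
  Every arrow of the cycle that avoids \<open>r\<^sub>i\<close> raises the rank by one, and the ranks are below \<open>a\<^sub>2\<close>.
\<close>

lemma length_cycle_path_avoiding:
  assumes "i \<le> a2" and "pre_digraph.cas (quiverQ a1 a2) u p v"
    and "\<And>e. e \<in> set p \<Longrightarrow> e \<in> cycle_arrows a2 \<and> fst e \<noteq> Rv i \<and> snd e \<noteq> Rv i"
    and "p \<noteq> []"
  shows "cycle_rank a2 i u + length p < a2"
  using assms(2-)
proof (induction p arbitrary: u)
  case (Cons e p)
  have e: "e \<in> cycle_arrows a2" "fst e \<noteq> Rv i" "snd e \<noteq> Rv i"
    using Cons.prems(2)[of e] by auto
  have u: "u = fst e" and p: "pre_digraph.cas (quiverQ a1 a2) (snd e) p v"
    using Cons.prems(1) by (simp_all add: pre_digraph.cas.simps quiverQ_def)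
  have rank: "cycle_rank a2 i (snd e) = Suc (cycle_rank a2 i u)" "cycle_rank a2 i (snd e) < a2"
    using e u assms(1) by (auto simp: cycle_arrows_def cycle_rank_def)
  show ?case
  proof (cases "p = []")
    case True
    with rank show ?thesis by simp
  next
    case False
    with Cons.IH[OF p] Cons.prems(2) rank show ?thesis by auto
  qed
qed simp

lemma A_module_modM:
  assumes "0 < a2" and "i \<le> a2"
  shows "A_module ((*) :: 'k::field \<Rightarrow> 'k \<Rightarrow> 'k) a1 a2 (modM a1 a2 i)"
proof -
  interpret vector_space "(*) :: 'k \<Rightarrow> 'k \<Rightarrow> 'k" by (rule vector_space_times)
  have "span {1} = UNIV"
    by (simp add: span_singleton)
  then have spans: "\<exists>B. finite B \<and> span B = {0}" "\<exists>B. finite B \<and> span B = UNIV"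
    by (metis finite.emptyI span_empty, metis finite.emptyI finite_insert)
  have "Defs.representation ((*) :: 'k \<Rightarrow> 'k \<Rightarrow> 'k) (quiverQ a1 a2) (modM a1 a2 i)"
    unfolding Defs.representation_def
  proof (intro conjI ballI)
    show "vector_space ((*) :: 'k \<Rightarrow> 'k \<Rightarrow> 'k)" by (rule vector_space_times)
  next
    fix v
    have space: "rep_space (modM a1 a2 i) v = {0 :: 'k} \<or> rep_space (modM a1 a2 i) v = (UNIV :: 'k set)"
      by (simp add: modM_simps)
    then show "subspace (rep_space (modM a1 a2 i) v)" by (simp only: subspace_field_iff)
    show "\<exists>B. finite B \<and> span B = rep_space (modM a1 a2 i) v"
      using space spans by metis
  next
    fix e
    show "linear_between ((*) :: 'k \<Rightarrow> 'k \<Rightarrow> 'k) (rep_space (modM a1 a2 i) (tail (quiverQ a1 a2) e))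
        (rep_space (modM a1 a2 i) (head (quiverQ a1 a2) e)) (rep_map (modM a1 a2 i) e)"
      by (simp add: linear_between_def modM_simps quiverQ_def Pi_iff)
  qed
  moreover have "rep_path (modM a1 a2 i) p x = (0 :: 'k)" if p: "p \<in> relations a1 a2" for p x
  proof -
    obtain u v where walk: "pre_digraph.cas (quiverQ a1 a2) u p v"
      and p': "set p \<subseteq> cycle_arrows a2" "length p = a2"
      using p by (auto simp: relations_def pre_digraph.awalk_def)
    have "\<exists>e\<in>set p. fst e = Rv i \<or> snd e = Rv i"
    proof (rule ccontr)
      assume "\<not> ?thesis"
      then have "cycle_rank a2 i u + length p < a2"
        using p' assms by (intro length_cycle_path_avoiding[OF _ walk]) auto
      with p'(2) show False by simp
    qed
    moreover have "Rv i \<notin> M_support a1 a2 i"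
      using assms by (simp add: support_simps)
    ultimately show ?thesis using rep_path_modM_eq_0 by metis
  qed
  ultimately show ?thesis by (auto simp: A_module_def satisfies_relations_def)
qed


section \<open>Closed subsets of the support\<close>

lemma ball_arcs_quiverQ:
  "(\<forall>e\<in>arcs (quiverQ a1 a2). P (tail (quiverQ a1 a2) e) (head (quiverQ a1 a2) e)) \<longleftrightarrow>
    (\<forall>k. k < a2 \<longrightarrow> P (Rv k) (Rv (Suc k))) \<and> P (Rv a2) (Rv 0) \<and>
    (\<forall>k. 1 \<le> k \<longrightarrow> Suc k < a1 \<longrightarrow> P (Sv k) (Sv (Suc k))) \<and>
    (1 < a1 \<longrightarrow> P (Sv (a1 - 1)) (Rv a2)) \<and>
    (1 < a1 \<longrightarrow> P (Rv 0) (Tv 1)) \<and>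
    (\<forall>k. 1 \<le> k \<longrightarrow> Suc k < a1 \<longrightarrow> P (Tv k) (Tv (Suc k)))"
proof -
  have cycle: "(\<forall>e\<in>cycle_arrows a2. P (fst e) (snd e)) \<longleftrightarrow>
      (\<forall>k. k < a2 \<longrightarrow> P (Rv k) (Rv (Suc k))) \<and> P (Rv a2) (Rv 0)"
    by (auto simp: cycle_arrows_def ball_Un split: if_splits)
  have S: "(\<forall>e\<in>S_arrows a1 a2. P (fst e) (snd e)) \<longleftrightarrow>
      (\<forall>k. 1 \<le> k \<longrightarrow> Suc k < a1 \<longrightarrow> P (Sv k) (Sv (Suc k))) \<and> (1 < a1 \<longrightarrow> P (Sv (a1 - 1)) (Rv a2))"
    by (auto simp: S_arrows_def ball_Un split: if_splits)
  have T: "(\<forall>e\<in>T_arrows a1. P (fst e) (snd e)) \<longleftrightarrow>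
      (1 < a1 \<longrightarrow> P (Rv 0) (Tv 1)) \<and> (\<forall>k. 1 \<le> k \<longrightarrow> Suc k < a1 \<longrightarrow> P (Tv k) (Tv (Suc k)))"
    by (auto simp: T_arrows_def ball_Un split: if_splits)
  show ?thesis
    by (simp add: quiverQ_def ball_Un cycle S T)
qed

lemma closed_subsets_quiverQ_iff:
  assumes "0 < a1" "0 < a2" "i \<le> a2"
  shows "X \<in> closed_subsets (quiverQ a1 a2) (M_support a1 a2 i) \<longleftrightarrow>
    X \<subseteq> M_support a1 a2 i \<and>
    (\<forall>k. k < a2 \<longrightarrow> Suc k \<noteq> i \<longrightarrow> Rv k \<in> X \<longrightarrow> Rv (Suc k) \<in> X) \<and>
    (i \<noteq> 0 \<longrightarrow> Rv a2 \<in> X \<longrightarrow> Rv 0 \<in> X) \<and>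
    (\<forall>k. 1 \<le> k \<longrightarrow> Suc k < a1 \<longrightarrow> Sv k \<in> X \<longrightarrow> Sv (Suc k) \<in> X) \<and>
    (1 < a1 \<longrightarrow> Sv (a1 - 1) \<in> X \<longrightarrow> Rv a2 \<in> X) \<and>
    (1 < a1 \<longrightarrow> Rv 0 \<in> X \<longrightarrow> Tv 1 \<in> X) \<and>
    (\<forall>k. 1 \<le> k \<longrightarrow> Suc k < a1 \<longrightarrow> Tv k \<in> X \<longrightarrow> Tv (Suc k) \<in> X)" (is "?L \<longleftrightarrow> _ \<and> ?R")
proof (cases "X \<subseteq> M_support a1 a2 i")
  case True
  note supp = support_simps[OF assms(2,3)]
  have sub: "Rv k \<in> X \<Longrightarrow> k \<noteq> i" "Sv k \<in> X \<Longrightarrow> i \<noteq> a2" "Tv k \<in> X \<Longrightarrow> i \<noteq> 0" for k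
    using True supp by blast+
  have "?L \<longleftrightarrow> (\<forall>e\<in>arcs (quiverQ a1 a2). tail (quiverQ a1 a2) e \<in> X \<longrightarrow>
      head (quiverQ a1 a2) e \<in> M_support a1 a2 i \<longrightarrow> head (quiverQ a1 a2) e \<in> X)"
    using True by (simp add: closed_subsets_def)
  also have "\<dots> \<longleftrightarrow> ?R"
    unfolding ball_arcs_quiverQ[where P = "\<lambda>u v. u \<in> X \<longrightarrow> v \<in> M_support a1 a2 i \<longrightarrow> v \<in> X"]
    using assms sub by (intro conj_cong all_cong1) (auto simp: supp)
  finally show ?thesis using True by simp
qed (auto simp: closed_subsets_def)

text \<open>A successor-closed part of a chain is a final segment; \<open>m = b\<close> encodes the empty one.\<close>

lemma final_segment:
  fixes a b :: nat
  assumes "\<And>k. a \<le> k \<Longrightarrow> Suc k < b \<Longrightarrow> P k \<Longrightarrow> P (Suc k)" and "a \<le> b"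
  obtains m where "a \<le> m" "m \<le> b" "\<And>k. a \<le> k \<Longrightarrow> k < b \<Longrightarrow> P k \<longleftrightarrow> m \<le> k"
proof -
  define m where "m = (LEAST k. a \<le> k \<and> (k = b \<or> P k))"
  have m: "a \<le> m \<and> (m = b \<or> P m)"
    unfolding m_def by (rule LeastI[of _ b]) (use assms in auto)
  have le: "m \<le> k" if "a \<le> k" "k = b \<or> P k" for k
    unfolding m_def by (rule Least_le) (use that in auto)
  have "P k" if "m \<le> k" "k < b" for k
    using that
  proof (induction k rule: dec_induct)
    case base
    with m show ?case by auto
  next
    case (step n)
    with m assms(1)[of n] show ?case by auto
  qed
  with m le assms(2) that show ?thesis by metis
qed

text \<open>
  In both families the indices \<open>j\<close> and \<open>m\<close> are the first places of the two final segments.  They run over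
  \<open>1 \<le> j \<le> i\<close> below and \<open>i < j \<le> a\<^sub>2\<close> above the middle set, and over \<open>1 \<le> m \<le> a\<^sub>1\<close>; the values \<open>j = i\<close>
  below and \<open>m = a\<^sub>1\<close> give empty segments.
\<close>

definition lower_set :: "nat \<Rightarrow> nat \<Rightarrow> nat \<times> nat \<Rightarrow> vertex set" where
  "lower_set a1 i = (\<lambda>(j, m). Rv ` {j..<i} \<union> Tv ` {m..<a1})"

definition middle_set :: "nat \<Rightarrow> nat \<Rightarrow> vertex set" where
  "middle_set a1 i = Rv ` {0..<i} \<union> (if i = 0 then {} else T_verts a1)"

definition upper_set :: "nat \<Rightarrow> nat \<Rightarrow> nat \<Rightarrow> nat \<times> nat \<Rightarrow> vertex set" where
  "upper_set a1 a2 i = (\<lambda>(j, m). middle_set a1 i \<union> Rv ` {j..a2} \<union> Sv ` {m..<a1})"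

lemma mem_lower_set [simp]:
  "Rv k \<in> lower_set a1 i (j, m) \<longleftrightarrow> j \<le> k \<and> k < i"
  "Sv k \<notin> lower_set a1 i (j, m)"
  "Tv k \<in> lower_set a1 i (j, m) \<longleftrightarrow> m \<le> k \<and> k < a1"
  by (auto simp: lower_set_def)

lemma mem_middle_set [simp]:
  "Rv k \<in> middle_set a1 i \<longleftrightarrow> k < i"
  "Sv k \<notin> middle_set a1 i"
  "Tv k \<in> middle_set a1 i \<longleftrightarrow> 1 \<le> k \<and> k < a1 \<and> i \<noteq> 0"
  by (auto simp: middle_set_def T_verts_def)

lemma mem_upper_set [simp]:
  "Rv k \<in> upper_set a1 a2 i (j, m) \<longleftrightarrow> k < i \<or> j \<le> k \<and> k \<le> a2"
  "Sv k \<in> upper_set a1 a2 i (j, m) \<longleftrightarrow> m \<le> k \<and> k < a1"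
  "Tv k \<in> upper_set a1 a2 i (j, m) \<longleftrightarrow> 1 \<le> k \<and> k < a1 \<and> i \<noteq> 0"
  by (auto simp: upper_set_def)

lemma vertex_set_eqI:
  assumes "\<And>k. Rv k \<in> X \<longleftrightarrow> Rv k \<in> Y" "\<And>k. Sv k \<in> X \<longleftrightarrow> Sv k \<in> Y" "\<And>k. Tv k \<in> X \<longleftrightarrow> Tv k \<in> Y"
  shows "X = Y"
proof (rule set_eqI)
  show "v \<in> X \<longleftrightarrow> v \<in> Y" for v
    using assms by (cases v) auto
qed

lemma vertex_subsetI:
  assumes "\<And>k. Rv k \<in> X \<Longrightarrow> Rv k \<in> Y" "\<And>k. Sv k \<in> X \<Longrightarrow> Sv k \<in> Y" "\<And>k. Tv k \<in> X \<Longrightarrow> Tv k \<in> Y"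
  shows "X \<subseteq> Y"
proof
  show "v \<in> Y" if "v \<in> X" for v
    using assms that by (cases v) auto
qed

text \<open>
  If a closed set contains \<open>r\<^bsub>a\<^sub>2\<^esub>\<close>, it contains the middle set, and only the segments of the \<open>s\<close>-branch
  and of the vertices between \<open>r\<^sub>i\<close> and \<open>r\<^bsub>a\<^sub>2\<^esub>\<close> are left to choose.  If it does not, nothing that leads to
  \<open>r\<^bsub>a\<^sub>2\<^esub>\<close> belongs to it, so it lies inside the middle set, with equality if it contains \<open>r\<^sub>0\<close>.
\<close>

lemma closed_subsets_quiverQ:
  assumes "0 < a1" "0 < a2" "i \<le> a2"
  shows "closed_subsets (quiverQ a1 a2) (M_support a1 a2 i) =
    lower_set a1 i ` ({1..i} \<times> {1..a1}) \<union> {middle_set a1 i} \<union>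
    upper_set a1 a2 i ` ({i<..a2} \<times> {1..a1})" (is "?C = ?L \<union> {?M} \<union> ?U")
proof (intro equalityI subsetI)
  note supp = support_simps[OF assms(2,3)]
  note closed_iff = closed_subsets_quiverQ_iff[OF assms]
  fix X
  {
    assume "X \<in> ?L \<union> {?M} \<union> ?U"
    then consider (L) j m where "X = lower_set a1 i (j, m)" "1 \<le> j" "j \<le> i" "1 \<le> m" "m \<le> a1"
      | (M) "X = ?M"
      | (U) j m where "X = upper_set a1 a2 i (j, m)" "i < j" "j \<le> a2" "1 \<le> m" "m \<le> a1"
      by auto
    then show "X \<in> ?C"
    proof cases
      case L
      have "X \<subseteq> M_support a1 a2 i"
        by (rule vertex_subsetI) (use L assms in \<open>auto simp: supp\<close>)
      with L assms show ?thesis unfolding closed_iff by auto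
    next
      case M
      have "X \<subseteq> M_support a1 a2 i"
        by (rule vertex_subsetI) (use M assms in \<open>auto simp: supp\<close>)
      with M assms show ?thesis unfolding closed_iff by auto
    next
      case U
      have "X \<subseteq> M_support a1 a2 i"
        by (rule vertex_subsetI) (use U assms in \<open>auto simp: supp\<close>)
      with U assms show ?thesis unfolding closed_iff by auto
    qed
  }
  assume "X \<in> ?C"
  then have XS: "X \<subseteq> M_support a1 a2 i"
    and R_step: "\<And>k. k < a2 \<Longrightarrow> Suc k \<noteq> i \<Longrightarrow> Rv k \<in> X \<Longrightarrow> Rv (Suc k) \<in> X"
    and R_back: "i \<noteq> 0 \<Longrightarrow> Rv a2 \<in> X \<Longrightarrow> Rv 0 \<in> X"
    and S_step: "\<And>k. 1 \<le> k \<Longrightarrow> Suc k < a1 \<Longrightarrow> Sv k \<in> X \<Longrightarrow> Sv (Suc k) \<in> X"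
    and S_end: "1 < a1 \<Longrightarrow> Sv (a1 - 1) \<in> X \<Longrightarrow> Rv a2 \<in> X"
    and T_start: "1 < a1 \<Longrightarrow> Rv 0 \<in> X \<Longrightarrow> Tv 1 \<in> X"
    and T_step: "\<And>k. 1 \<le> k \<Longrightarrow> Suc k < a1 \<Longrightarrow> Tv k \<in> X \<Longrightarrow> Tv (Suc k) \<in> X"
    unfolding closed_iff by blast+
  have RX: "k \<le> a2 \<and> k \<noteq> i" if "Rv k \<in> X" for k using that XS supp by blast
  have SX: "1 \<le> k \<and> k < a1 \<and> i \<noteq> a2" if "Sv k \<in> X" for k using that XS supp by blast
  have TX: "1 \<le> k \<and> k < a1 \<and> i \<noteq> 0" if "Tv k \<in> X" for k using that XS supp by blast

  obtain mS where mS: "1 \<le> mS" "mS \<le> a1" "\<And>k. 1 \<le> k \<Longrightarrow> k < a1 \<Longrightarrow> Sv k \<in> X \<longleftrightarrow> mS \<le> k"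
    by (rule final_segment[of 1 a1 "\<lambda>k. Sv k \<in> X", OF S_step]) (use assms(1) in auto)
  obtain mT where mT: "1 \<le> mT" "mT \<le> a1" "\<And>k. 1 \<le> k \<Longrightarrow> k < a1 \<Longrightarrow> Tv k \<in> X \<longleftrightarrow> mT \<le> k"
    by (rule final_segment[of 1 a1 "\<lambda>k. Tv k \<in> X", OF T_step]) (use assms(1) in auto)
  obtain jh where jh: "Suc i \<le> jh" "jh \<le> Suc a2"
      "\<And>k. Suc i \<le> k \<Longrightarrow> k < Suc a2 \<Longrightarrow> Rv k \<in> X \<longleftrightarrow> jh \<le> k"
    by (rule final_segment[of "Suc i" "Suc a2" "\<lambda>k. Rv k \<in> X", OF R_step]) (use assms(3) in auto)
  obtain jl where jl: "jl \<le> i" "\<And>k. k < i \<Longrightarrow> Rv k \<in> X \<longleftrightarrow> jl \<le> k"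
    by (rule final_segment[of 0 i "\<lambda>k. Rv k \<in> X", OF R_step]) (use assms(3) in auto)

  \<comment> \<open>As soon as the middle set has to be contained in \<open>X\<close>, the segments given by \<open>jl\<close> and \<open>mT\<close> are full.\<close>
  have middle: "(Rv k \<in> X \<longleftrightarrow> k < i \<or> jh \<le> k \<and> k \<le> a2)"
      "(Tv k \<in> X \<longleftrightarrow> 1 \<le> k \<and> k < a1 \<and> i \<noteq> 0)" if r0: "i \<noteq> 0 \<longrightarrow> Rv 0 \<in> X" for k
  proof -
    have "i \<noteq> 0 \<Longrightarrow> jl = 0"
      using r0 jl(2)[of 0] by simp
    then show "Rv k \<in> X \<longleftrightarrow> k < i \<or> jh \<le> k \<and> k \<le> a2"
      using jl(2)[of k] jh(1,2) jh(3)[of k] RX[of k] by (cases k i rule: linorder_cases) auto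
    have "i \<noteq> 0 \<Longrightarrow> mT = 1" if "1 < a1"
      using r0 T_start mT(1) mT(3)[of 1] that by auto
    then show "Tv k \<in> X \<longleftrightarrow> 1 \<le> k \<and> k < a1 \<and> i \<noteq> 0"
      using mT(3)[of k] TX[of k] by (cases "i = 0") auto
  qed

  show "X \<in> ?L \<union> {?M} \<union> ?U"
  proof (cases "Rv a2 \<in> X")
    case True
    have "i < a2" using RX[OF True] assms(3) by simp
    have "jh \<le> a2" using True jh(3)[of a2] \<open>i < a2\<close> by simp
    have "i \<noteq> 0 \<longrightarrow> Rv 0 \<in> X" using R_back True by blast
    moreover have "Sv k \<in> X \<longleftrightarrow> mS \<le> k \<and> k < a1" for k
      using SX[of k] mS(1) mS(3)[of k] by linarith
    ultimately have "X = upper_set a1 a2 i (jh, mS)"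
      by (intro vertex_set_eqI) (simp_all add: middle)
    moreover have "(jh, mS) \<in> {i<..a2} \<times> {1..a1}"
      using \<open>jh \<le> a2\<close> jh(1) mS by auto
    ultimately show ?thesis by blast
  next
    case False
    have no_S: "Sv k \<notin> X" for k
    proof
      assume "Sv k \<in> X"
      then have "1 \<le> k" "k < a1" "mS \<le> k" using SX mS(3) by blast+
      then have "Sv (a1 - 1) \<in> X" by (subst mS(3)) linarith+
      moreover have "1 < a1" using \<open>1 \<le> k\<close> \<open>k < a1\<close> by linarith
      ultimately show False using S_end False by blast
    qed
    have jh_eq: "jh = Suc a2"
    proof (cases "i = a2")
      case True
      with jh show ?thesis by simp
    next
      case i: False
      with False jh(2) jh(3)[of a2] assms(3) show ?thesis by simp
    qed
    show ?thesis
    proof (cases "i \<noteq> 0 \<longrightarrow> Rv 0 \<in> X")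
      case True
      have "X = ?M"
        using middle[OF True] no_S jh_eq by (intro vertex_set_eqI) auto
      then show ?thesis by blast
    next
      case r0: False
      then have "1 \<le> jl" using jl(2)[of 0] by simp
      have "Rv k \<in> X \<longleftrightarrow> jl \<le> k \<and> k < i" for k
        using jl(2)[of k] jh(3)[of k] jh_eq RX[of k] by (cases k i rule: linorder_cases) auto
      moreover have "Tv k \<in> X \<longleftrightarrow> mT \<le> k \<and> k < a1" for k
        using TX[of k] mT(1) mT(3)[of k] by linarith
      ultimately have "X = lower_set a1 i (jl, mT)"
        using no_S by (intro vertex_set_eqI) simp_all
      moreover have "(jl, mT) \<in> {1..i} \<times> {1..a1}"
        using \<open>1 \<le> jl\<close> jl(1) mT by auto
      ultimately show ?thesis by blast
    qed
  qed
qed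

lemma final_segment_inj:
  fixes m m' b :: nat
  assumes "\<And>k. m \<le> k \<and> k < b \<longleftrightarrow> m' \<le> k \<and> k < b" and "m \<le> b" "m' \<le> b"
  shows "m = m'"
  using assms(1)[of m] assms(1)[of m'] assms(2,3) by auto

lemma inj_on_lower_set: "inj_on (lower_set a1 i) ({1..i} \<times> {1..a1})"
proof (rule inj_onI, clarify)
  fix j m j' m'
  assume "j \<in> {1..i}" "m \<in> {1..a1}" "j' \<in> {1..i}" "m' \<in> {1..a1}"
    and eq: "lower_set a1 i (j, m) = lower_set a1 i (j', m')"
  moreover have "j \<le> k \<and> k < i \<longleftrightarrow> j' \<le> k \<and> k < i" "m \<le> k \<and> k < a1 \<longleftrightarrow> m' \<le> k \<and> k < a1" for k
    using eq by (metis mem_lower_set)+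
  ultimately show "j = j' \<and> m = m'"
    using final_segment_inj[of j i j'] final_segment_inj[of m a1 m'] by simp
qed

lemma inj_on_upper_set: "inj_on (upper_set a1 a2 i) ({i<..a2} \<times> {1..a1})"
proof (rule inj_onI, clarify)
  fix j m j' m'
  assume ranges: "j \<in> {i<..a2}" "m \<in> {1..a1}" "j' \<in> {i<..a2}" "m' \<in> {1..a1}"
    and eq: "upper_set a1 a2 i (j, m) = upper_set a1 a2 i (j', m')"
  have R: "k < i \<or> j \<le> k \<and> k \<le> a2 \<longleftrightarrow> k < i \<or> j' \<le> k \<and> k \<le> a2"
    and S: "m \<le> k \<and> k < a1 \<longleftrightarrow> m' \<le> k \<and> k < a1" for k
    using eq by (metis mem_upper_set)+
  show "j = j' \<and> m = m'"
    using ranges R[of j] R[of j'] S final_segment_inj[of m a1 m'] by auto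
qed

lemma card_closed_subsets_quiverQ:
  assumes "0 < a1" "0 < a2" "i \<le> a2"
  shows "card (closed_subsets (quiverQ a1 a2) (M_support a1 a2 i)) = a1 * a2 + 1"
proof -
  define L where "L = lower_set a1 i ` ({1..i} \<times> {1..a1})"
  define U where "U = upper_set a1 a2 i ` ({i<..a2} \<times> {1..a1})"
  let ?M = "middle_set a1 i"
  \<comment> \<open>The vertices \<open>r\<^bsub>a\<^sub>2\<^esub>\<close> and \<open>r\<^sub>0\<close> tell the three kinds of closed sets apart.\<close>
  have in_U: "Rv a2 \<in> X" if "X \<in> U" for X using that by (auto simp: U_def)
  have in_L: "Rv a2 \<notin> X \<and> i \<noteq> 0 \<and> Rv 0 \<notin> X" if "X \<in> L" for X using that assms by (auto simp: L_def)
  have M: "Rv a2 \<notin> ?M" "i \<noteq> 0 \<Longrightarrow> Rv 0 \<in> ?M" using assms by auto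
  have "?M \<notin> L"
    using in_L M(2) by metis
  moreover have "(L \<union> {?M}) \<inter> U = {}"
    using in_U in_L M(1) by blast
  moreover have "finite L" "finite U" by (simp_all add: L_def U_def)
  ultimately have "card (L \<union> {?M} \<union> U) = card L + 1 + card U"
    by (subst card_Un_disjoint) auto
  also have "card L = i * a1"
    unfolding L_def card_image[OF inj_on_lower_set] by simp
  also have "card U = (a2 - i) * a1"
    unfolding U_def card_image[OF inj_on_upper_set] by simp
  also have "i * a1 + 1 + (a2 - i) * a1 = a1 * a2 + 1"
    using assms(3) by (simp flip: add_mult_distrib)
  finally show ?thesis by (simp add: closed_subsets_quiverQ[OF assms] L_def U_def)
qed


section \<open>Counting the submodules of \<open>M(r\<^sub>i)\<close>\<close>

theorem proposition3p4:
  fixes a1 a2 i :: nat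
  assumes "0 < a1" and "0 < a2" and "i \<le> a2"
  shows "A_module ((*) :: 'k::alg_closed_field \<Rightarrow> 'k \<Rightarrow> 'k) a1 a2 (modM a1 a2 i) \<and>
    card (submodules ((*) :: 'k \<Rightarrow> 'k \<Rightarrow> 'k) (quiverQ a1 a2) (modM a1 a2 i)) = a1 * a2 + 1"
proof
  show "A_module ((*) :: 'k \<Rightarrow> 'k \<Rightarrow> 'k) a1 a2 (modM a1 a2 i)"
    using assms(2,3) by (rule A_module_modM)
  interpret fin_digraph "quiverQ a1 a2" by (rule fin_digraph_quiverQ)
  have "card (submodules ((*) :: 'k \<Rightarrow> 'k \<Rightarrow> 'k) (quiverQ a1 a2) (modM a1 a2 i)) =
      card (closed_subsets (quiverQ a1 a2) (M_support a1 a2 i))"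
  proof (rule card_submodules_thin)
    show "wf_digraph (quiverQ a1 a2)" by unfold_locales
    show "M_support a1 a2 i \<subseteq> verts (quiverQ a1 a2)"
      by (auto simp: M_support_def quiverQ_def)
  qed (auto simp: modM_simps quiverQ_def)
  also have "\<dots> = a1 * a2 + 1"
    using assms by (rule card_closed_subsets_quiverQ)
  finally show "card (submodules ((*) :: 'k \<Rightarrow> 'k \<Rightarrow> 'k) (quiverQ a1 a2) (modM a1 a2 i)) =
      a1 * a2 + 1" .
qed

end
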